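(* Max Shift is consistent: for every mode $x_*$ of $f$ and every $x_0$ in the basin of attraction of $x_*$, there is $\varepsilon_0>0$ such that for all $\varepsilon\in(0,\varepsilon_0]$ the Max Shift sequence with neighborhood size $\varepsilon$ initialized at $x_0$ converges to $x_*$.
   Context: Density. $f$ is a probability density on $\mathbb{R}^d$ with respect to Lebesgue measure such that: (i) $f(x)\to0$ as $\|x\|\to\infty$; (ii) $f$ is twice differentiable everywhere, and $f$, $\nabla f$, $\nabla^2 f$ are bounded and uniformly continuous; (iii) the Hessian $\nabla^2 f$ is non-singular at every critical point of $f$. A mode is a local maximum of $f$. Gradient flow. For $x\in\mathbb{R}^d$, $\gamma_x:[0,\infty)\to\mathbb{R}^d$ is the solution of $\gamma_x(0)=x$, $\dot\gamma_x(t)=\nabla f(\gamma_x(t))$; $\gamma_x(t)$ converges to a critical point of $f$ as $t\to\infty$, denoted $\gamma_x(\infty)$. The basin of attraction of $x_*$ is $\{x:\gamma_x(\infty)=x_*\}$. Max Shift. Given $\varepsilon>0$ and a starting point $x_0$, define $x(0)=x_0$ and $x(k+1)\in\operatorname{arg\,max}_{x\in\bar B(x(k),\varepsilon)}f(x)$ for $k\ge0$, where $\bar B(x,\varepsilon)$ is the closed ball; ties are broken in an arbitrary but deterministic way, and if $f(x(k+1))=f(x(k))$ the process stops (at $x(k)$). A process that stops is said to converge to the point where it stops. *)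

theory Defs
  imports "HOL-Analysis.Analysis"
begin

definition grad :: "(real ^ 'n \<Rightarrow> real) \<Rightarrow> real ^ 'n \<Rightarrow> real ^ 'n" where
  "grad f x = (THE D. GDERIV f x :> D)"

definition hessian :: "(real ^ 'n \<Rightarrow> real) \<Rightarrow> real ^ 'n \<Rightarrow> real ^ 'n ^ 'n" where
  "hessian f x = jacobian (grad f) (at x)"

lemma GDERIV_grad:
  fixes f :: "real ^ 'n \<Rightarrow> real"
  assumes "f differentiable (at x)"
  shows "GDERIV f x :> grad f x"
proof -
  obtain f' where f': "(f has_derivative f') (at x)"
    using assms by (auto simp: differentiable_def)
  interpret bounded_linear f' using f' by (rule has_derivative_bounded_linear)
  let ?D = "\<Sum>b\<in>Basis. f' b *\<^sub>R b"
  have "f' h = inner h ?D" for h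
  proof -
    have "f' h = f' (\<Sum>b\<in>Basis. inner h b *\<^sub>R b)"
      by (simp add: euclidean_representation)
    also have "\<dots> = inner h ?D"
      by (simp add: sum scaleR inner_sum_right mult.commute)
    finally show ?thesis .
  qed
  then have "f' = (\<lambda>h. inner h ?D)" by (rule ext)
  with f' have ex: "GDERIV f x :> ?D" unfolding gderiv_def by (rule subst[rotated])
  have uniq: "D = ?D" if "GDERIV f x :> D" for D
  proof -
    have "(\<lambda>h. inner h D) = (\<lambda>h. inner h ?D)"
      using that ex unfolding gderiv_def by (rule has_derivative_unique)
    then have "\<forall>h. inner h D = inner h ?D" by (rule fun_cong[THEN allI])
    then show ?thesis by (rule iffD1[OF vector_eq_ldot])
  qed
  show ?thesis unfolding grad_def using ex uniq by (rule theI)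
qed

definition prob_density :: "(real ^ 'n \<Rightarrow> real) \<Rightarrow> bool" where
  "prob_density f \<longleftrightarrow> (\<forall>x. 0 \<le> f x) \<and> has_bochner_integral lborel f 1"

definition bounded_unif_cont :: "('a::metric_space \<Rightarrow> 'b::metric_space) \<Rightarrow> bool" where
  "bounded_unif_cont g \<longleftrightarrow> bounded (range g) \<and> uniformly_continuous_on UNIV g"

definition critical_point :: "(real ^ 'n \<Rightarrow> real) \<Rightarrow> real ^ 'n \<Rightarrow> bool" where
  "critical_point f x \<longleftrightarrow> grad f x = 0"

definition regular_density :: "(real ^ 'n \<Rightarrow> real) \<Rightarrow> bool" where
  "regular_density f \<longleftrightarrow>
     prob_density f \<and>
     (f \<longlongrightarrow> 0) at_infinity \<and>
     (\<forall>x. f differentiable (at x)) \<and>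
     (\<forall>x. grad f differentiable (at x)) \<and>
     bounded_unif_cont f \<and> bounded_unif_cont (grad f) \<and> bounded_unif_cont (hessian f) \<and>
     (\<forall>x. critical_point f x \<longrightarrow> invertible (hessian f x))"

definition is_mode :: "(real ^ 'n \<Rightarrow> real) \<Rightarrow> real ^ 'n \<Rightarrow> bool" where
  "is_mode f x \<longleftrightarrow> (\<exists>r>0. \<forall>y\<in>ball x r. f y \<le> f x)"

definition gradient_flow_line ::
    "(real ^ 'n \<Rightarrow> real) \<Rightarrow> real ^ 'n \<Rightarrow> (real \<Rightarrow> real ^ 'n) \<Rightarrow> bool" where
  "gradient_flow_line f x \<gamma> \<longleftrightarrow>
     \<gamma> 0 = x \<and>
     (\<forall>t\<ge>0. (\<gamma> has_vector_derivative grad f (\<gamma> t)) (at t within {0..}))"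

text \<open>Under the assumptions on the density, \<^term>\<open>grad f\<close> is Lipschitz, so the flow line
  from \<open>x\<close> is unique on \<open>{0..}\<close> and the existential quantifier below refers to that solution.\<close>

definition basin :: "(real ^ 'n \<Rightarrow> real) \<Rightarrow> real ^ 'n \<Rightarrow> (real ^ 'n) set" where
  "basin f xs = {x. \<exists>\<gamma>. gradient_flow_line f x \<gamma> \<and> (\<gamma> \<longlongrightarrow> xs) at_top}"

text \<open>A deterministic tie-breaking rule: \<open>S \<epsilon> x\<close> is the maximizer selected in \<open>cball x \<epsilon>\<close>.\<close>

definition max_shift_rule ::
    "(real ^ 'n \<Rightarrow> real) \<Rightarrow> (real \<Rightarrow> real ^ 'n \<Rightarrow> real ^ 'n) \<Rightarrow> bool" where
  "max_shift_rule f S \<longleftrightarrow>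
     (\<forall>\<epsilon>>0. \<forall>x. is_arg_max f (\<lambda>y. y \<in> cball x \<epsilon>) (S \<epsilon> x))"

text \<open>The unstopped iterates; the stopping rule enters through \<open>stops_at\<close>, and iterates
  after the stopping time play no role in \<open>process_converges\<close>.\<close>

primrec max_shift ::
    "(real \<Rightarrow> real ^ 'n \<Rightarrow> real ^ 'n) \<Rightarrow> real \<Rightarrow> real ^ 'n \<Rightarrow> nat \<Rightarrow> real ^ 'n" where
  "max_shift S \<epsilon> x0 0 = x0"
| "max_shift S \<epsilon> x0 (Suc k) = S \<epsilon> (max_shift S \<epsilon> x0 k)"

definition stops_at :: "(real ^ 'n \<Rightarrow> real) \<Rightarrow> (nat \<Rightarrow> real ^ 'n) \<Rightarrow> nat \<Rightarrow> bool" where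
  "stops_at f x k \<longleftrightarrow> f (x (Suc k)) = f (x k) \<and> (\<forall>j<k. f (x (Suc j)) \<noteq> f (x j))"

definition process_converges ::
    "(real ^ 'n \<Rightarrow> real) \<Rightarrow> (nat \<Rightarrow> real ^ 'n) \<Rightarrow> real ^ 'n \<Rightarrow> bool" where
  "process_converges f x l \<longleftrightarrow>
     (\<exists>k. stops_at f x k \<and> x k = l) \<or> ((\<nexists>k. stops_at f x k) \<and> x \<longlonglongrightarrow> l)"

end

theory Submission
  imports Defs
begin

text \<open>
  For small \<open>\<epsilon>\<close> the Max Shift step is a perturbed Euler step of the gradient flow. Write
  \<open>g = grad f\<close>, which is \<open>L\<close>-Lipschitz because the Hessian is bounded. Maximizing the linear
  approximation of \<open>f\<close> over the ball of radius \<open>\<epsilon>\<close> around \<open>x\<close> moves by \<open>\<tau> g(x)\<close> with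
  \<open>\<tau> = \<epsilon> / |g(x)|\<close>; the true maximizer deviates from that by at most
  \<open>\<tau> sqrt (4 L \<epsilon> |g(x)|)\<close> (lemma \<open>arg_max_step_Euler\<close>), since a maximizer pointing in a
  noticeably different direction would lose against the Euler point itself. So one step
  corresponds to flow time \<open>\<tau>\<close>, with a local error that is \<open>\<tau>\<close> times a quantity vanishing
  with \<open>\<epsilon>\<close>.

  A flow line that converges to the mode \<open>xs\<close> and starts elsewhere meets no critical point in
  finite time (\<open>convergent_flow_not_critical\<close>), hence \<open>|g|\<close> is bounded below along it up to
  any fixed time. A discrete Gronwall argument then keeps the iterates uniformly close to the
  flow line until the latter is near \<open>xs\<close> (\<open>max_shift_tracks_flow\<close>).

  Near \<open>xs\<close> the Hessian being non-singular makes \<open>xs\<close> an isolated critical point, and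
  therefore a strict local maximum (\<open>mode_well\<close>). As the values of \<open>f\<close> along the iterates
  never decrease and the steps are short, the iterates cannot cross an annulus around \<open>xs\<close> on
  which \<open>f\<close> is smaller (\<open>arg_max_sequence_trapped\<close>). Inside it, every iterate at distance
  at least \<open>e\<close> from \<open>xs\<close> is followed by an increase of \<open>f\<close> by a fixed amount, which can
  happen only finitely often (\<open>arg_max_sequence_converges\<close>). If the process stops, it
  stops at a local maximum, so at a critical point, and \<open>xs\<close> is the only candidate.
\<close>

section \<open>First-order estimates\<close>

lemma regular_has_derivative:
  assumes "regular_density f"
  shows "(f has_derivative (\<lambda>h. h \<bullet> grad f x)) (at x)"
  using GDERIV_grad[of f x] assms by (simp add: regular_density_def gderiv_def)

lemma regular_has_derivative_grad:
  assumes "regular_density f"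
  shows "(grad f has_derivative (\<lambda>h. hessian f x *v h)) (at x)"
  using assms jacobian_works[of "grad f" "at x"] by (simp add: regular_density_def hessian_def)

lemma regular_grad_Lipschitz:
  fixes f :: "real ^ 'n \<Rightarrow> real"
  assumes "regular_density f"
  obtains L where "L > 0" "\<And>x y. norm (grad f x - grad f y) \<le> L * norm (x - y)"
proof -
  have "bounded (range (hessian f))"
    using assms by (simp add: regular_density_def bounded_unif_cont_def)
  then obtain B where B: "norm (hessian f x) \<le> B" for x
    by (auto simp: bounded_iff)
  define L where "L = max 1 (real CARD('n) * real CARD('n) * B)"
  have "norm (grad f x - grad f y) \<le> L * norm (x - y)" for x y
  proof (rule differentiable_bound[where S = UNIV and f' = "\<lambda>z. (*v) (hessian f z)"])
    show "(grad f has_derivative (*v) (hessian f z)) (at z within UNIV)" for z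
      using regular_has_derivative_grad[OF assms, of z] by simp
    have "\<bar>hessian f z $ i $ j\<bar> \<le> B" for z i j
      by (metis B Finite_Cartesian_Product.norm_nth_le order_trans real_norm_def)
    then show "onorm ((*v) (hessian f z)) \<le> L" for z
      unfolding L_def by (intro max.coboundedI2 onorm_le_matrix_component)
  qed auto
  moreover have "L > 0" by (simp add: L_def)
  ultimately show thesis using that by blast
qed

lemma local_max_critical:
  assumes "(f has_derivative (\<lambda>h. h \<bullet> grad f x)) (at x)" and "r > 0"
    and "\<forall>y\<in>ball x r. f y \<le> f x"
  shows "grad f x = 0"
proof -
  have "(\<lambda>h. h \<bullet> grad f x) = (\<lambda>h. 0)"
    using differential_zero_maxmin[of x "ball x r" f] assms by auto
  then have "grad f x \<bullet> grad f x = 0" by metis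
  then show ?thesis by simp
qed

text \<open>
  The sharp constant would be \<open>L / 2\<close>; the constant \<open>L\<close> comes directly from the mean value
  inequality for \<open>f\<close> minus its linearization on the ball of radius \<open>|h|\<close>.
\<close>

lemma first_order_remainder:
  fixes f :: "real ^ 'n \<Rightarrow> real"
  assumes der: "\<And>x. (f has_derivative (\<lambda>h. h \<bullet> grad f x)) (at x)"
    and lip: "\<And>x y. norm (grad f x - grad f y) \<le> L * norm (x - y)" and "L > 0"
  shows "\<bar>f (x + h) - f x - h \<bullet> grad f x\<bar> \<le> L * (norm h)\<^sup>2"
proof -
  let ?S = "cball x (norm h)"
  have "norm (f (x + h) - f x - (\<lambda>v. v \<bullet> grad f x) ((x + h) - x))
      \<le> norm ((x + h) - x) * (L * norm h)"
  proof (rule differentiable_bound_linearization[where S = ?S and f' = "\<lambda>z v. v \<bullet> grad f z"])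
    show "x + t *\<^sub>R (x + h - x) \<in> ?S" if "t \<in> {0..1}" for t
      using that by (simp add: dist_norm mult_left_le_one_le)
    show "(f has_derivative (\<lambda>v. v \<bullet> grad f z)) (at z within ?S)" for z
      using der has_derivative_at_withinI by blast
    show "onorm ((\<lambda>v. v \<bullet> grad f z) - (\<lambda>v. v \<bullet> grad f x)) \<le> L * norm h" if "z \<in> ?S" for z
    proof (rule onorm_le)
      fix v
      have "\<bar>v \<bullet> (grad f z - grad f x)\<bar> \<le> norm v * norm (grad f z - grad f x)"
        by (rule Cauchy_Schwarz_ineq2)
      also have "\<dots> \<le> norm v * (L * norm (z - x))"
        by (intro mult_left_mono lip) auto
      also have "\<dots> \<le> norm v * (L * norm h)"
        using that \<open>L > 0\<close> by (intro mult_left_mono) (auto simp: dist_norm norm_minus_commute)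
      finally show "norm (((\<lambda>v. v \<bullet> grad f z) - (\<lambda>v. v \<bullet> grad f x)) v) \<le> L * norm h * norm v"
        by (simp add: inner_diff_right mult.commute)
    qed
  qed auto
  then show ?thesis by (simp add: power2_eq_square algebra_simps)
qed

text \<open>
  The gain is realized by the point at distance \<open>s\<close> in the direction of the gradient, and the
  maximizer can only do better. The choice \<open>s = \<epsilon>\<close> enters the Euler estimate; a smaller \<open>s\<close>
  makes the quadratic loss negligible when \<open>\<epsilon>\<close> is large compared with the gradient.
\<close>

lemma ascent_along_gradient:
  fixes f :: "real ^ 'n \<Rightarrow> real"
  assumes der: "\<And>x. (f has_derivative (\<lambda>h. h \<bullet> grad f x)) (at x)"
    and lip: "\<And>x y. norm (grad f x - grad f y) \<le> L * norm (x - y)" and "L > 0"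
    and max: "is_arg_max f (\<lambda>y. y \<in> cball x \<epsilon>) x'"
    and s: "0 \<le> s" "s \<le> \<epsilon>" and "grad f x \<noteq> 0"
  shows "f x + s * norm (grad f x) - L * s\<^sup>2 \<le> f x'"
proof -
  let ?h = "(s / norm (grad f x)) *\<^sub>R grad f x"
  have nh: "norm ?h = s" using assms by simp
  then have "x + ?h \<in> cball x \<epsilon>" using s by (simp add: dist_norm)
  then have "f (x + ?h) \<le> f x'" using max by (auto simp: is_arg_max_linorder)
  moreover have "\<bar>f (x + ?h) - f x - ?h \<bullet> grad f x\<bar> \<le> L * s\<^sup>2"
    using first_order_remainder[of f L x ?h, OF der lip \<open>L > 0\<close>] nh by simp
  moreover have "?h \<bullet> grad f x = s * norm (grad f x)"
    using assms by (simp add: dot_square_norm power2_eq_square)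
  ultimately show ?thesis by linarith
qed

text \<open>
  Comparing the maximal value with its value at the Euler point shows that the step \<open>u\<close> has an
  inner product with the gradient of at least \<open>\<epsilon> |g| - 2 L \<epsilon>\<^sup>2\<close>. As \<open>|u| \<le> \<epsilon>\<close>, the
  Cauchy-Schwarz inequality is almost an equality, which forces \<open>u\<close> to be close to the
  multiple of the gradient of length \<open>\<epsilon>\<close>.
\<close>

lemma arg_max_step_Euler:
  fixes f :: "real ^ 'n \<Rightarrow> real"
  assumes der: "\<And>x. (f has_derivative (\<lambda>h. h \<bullet> grad f x)) (at x)"
    and lip: "\<And>x y. norm (grad f x - grad f y) \<le> L * norm (x - y)" and "L > 0"
    and max: "is_arg_max f (\<lambda>y. y \<in> cball x \<epsilon>) x'"
    and "\<epsilon> > 0" and "grad f x \<noteq> 0"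
  defines "\<tau> \<equiv> \<epsilon> / norm (grad f x)"
  shows "norm (x' - x - \<tau> *\<^sub>R grad f x) \<le> \<tau> * sqrt (4 * L * \<epsilon> * norm (grad f x))"
proof -
  define u where "u = x' - x"
  define n where "n = norm (grad f x)"
  have n: "n > 0" "\<tau> * n = \<epsilon>" "\<tau> > 0" using assms by (auto simp: n_def)
  have nu: "norm u \<le> \<epsilon>"
    using max by (simp add: is_arg_max_linorder u_def dist_norm norm_minus_commute)
  then have nu2: "(norm u)\<^sup>2 \<le> \<epsilon>\<^sup>2" by (simp add: power_mono)
  have "f x' - f x - u \<bullet> grad f x \<le> L * (norm u)\<^sup>2"
    using first_order_remainder[of f L x u, OF der lip \<open>L > 0\<close>] by (simp add: u_def)
  also have "\<dots> \<le> L * \<epsilon>\<^sup>2" using nu2 \<open>L > 0\<close> by simp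
  finally have "u \<bullet> grad f x \<ge> \<epsilon> * n - 2 * L * \<epsilon>\<^sup>2"
    using ascent_along_gradient[of f L x \<epsilon> x' \<epsilon>, OF der lip \<open>L > 0\<close> max] assms
    by (simp add: n_def)
  then have ug: "\<tau> * (u \<bullet> grad f x) \<ge> \<tau> * (\<epsilon> * n - 2 * L * \<epsilon>\<^sup>2)"
    using n by (intro mult_left_mono) auto
  have "(norm (u - \<tau> *\<^sub>R grad f x))\<^sup>2 = (norm u)\<^sup>2 - 2 * (\<tau> * (u \<bullet> grad f x)) + (\<tau> * n)\<^sup>2"
    by (simp add: n_def power2_norm_eq_inner inner_diff inner_commute algebra_simps
        power_mult_distrib) (simp add: power2_eq_square)
  also have "\<dots> \<le> \<epsilon>\<^sup>2 - 2 * (\<tau> * (\<epsilon> * n - 2 * L * \<epsilon>\<^sup>2)) + \<epsilon>\<^sup>2"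
    unfolding n(2) using nu2 ug by linarith
  also have "\<dots> = 2 * \<epsilon>\<^sup>2 - 2 * \<epsilon> * (\<tau> * n) + 4 * L * \<tau> * \<epsilon> * \<epsilon>"
    by (simp add: algebra_simps power2_eq_square)
  also have "\<dots> = 4 * L * \<tau> * \<epsilon> * (\<tau> * n)"
    unfolding n(2) by (simp add: power2_eq_square)
  also have "\<dots> = (\<tau> * sqrt (4 * L * \<epsilon> * n))\<^sup>2"
  proof -
    have "(sqrt (4 * L * \<epsilon> * n))\<^sup>2 = 4 * L * \<epsilon> * n"
      using n(1) \<open>L > 0\<close> \<open>\<epsilon> > 0\<close> by simp
    then show ?thesis unfolding power_mult_distrib by (simp only: power2_eq_square mult_ac)
  qed
  finally have "norm (u - \<tau> *\<^sub>R grad f x) \<le> \<tau> * sqrt (4 * L * \<epsilon> * n)"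
    by (rule power2_le_imp_le) (use n assms in auto)
  then show ?thesis by (simp add: u_def n_def)
qed

section \<open>The gradient flow\<close>

lemma flow_Euler_error:
  fixes f :: "real ^ 'n \<Rightarrow> real"
  assumes flow: "gradient_flow_line f x0 \<gamma>"
    and lip: "\<And>x y. norm (grad f x - grad f y) \<le> L * norm (x - y)" and "L > 0"
    and bd: "\<And>x. norm (grad f x) \<le> M"
    and "t \<ge> 0" "\<tau> \<ge> 0"
  shows "norm (\<gamma> (t + \<tau>) - \<gamma> t - \<tau> *\<^sub>R grad f (\<gamma> t)) \<le> \<tau> * (L * (M * \<tau>))"
proof -
  let ?I = "{t..t + \<tau>}"
  have der: "(\<gamma> has_vector_derivative grad f (\<gamma> s)) (at s within ?I)" if "s \<in> ?I" for s
    using flow that \<open>t \<ge> 0\<close> unfolding gradient_flow_line_def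
    by (intro has_vector_derivative_within_subset[where S = "{0..}" and T = ?I]) auto
  have speed: "norm (\<gamma> s - \<gamma> t) \<le> M * \<tau>" if "s \<in> ?I" for s
  proof -
    have "norm (\<gamma> s - \<gamma> t) \<le> M * norm (s - t)"
    proof (rule differentiable_bound[where S = ?I and f' = "\<lambda>s h. h *\<^sub>R grad f (\<gamma> s)"])
      show "(\<gamma> has_derivative (\<lambda>h. h *\<^sub>R grad f (\<gamma> s))) (at s within ?I)" if "s \<in> ?I" for s
        using der[OF that] by (simp add: has_vector_derivative_def)
      show "onorm (\<lambda>h. h *\<^sub>R grad f (\<gamma> s)) \<le> M" for s
        using bd by (intro onorm_le) (simp add: mult.commute[of M] mult_left_mono)
    qed (use that in auto)
    also have "\<dots> \<le> M * \<tau>"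
      using that order_trans[OF norm_ge_zero bd] by (intro mult_left_mono) auto
    finally show ?thesis .
  qed
  have "norm (\<gamma> (t + \<tau>) - \<gamma> t - (t + \<tau> - t) *\<^sub>R grad f (\<gamma> t)) \<le> norm (t + \<tau> - t) * (L * (M * \<tau>))"
  proof (rule vector_differentiable_bound_linearization[where S = ?I])
    show "norm (grad f (\<gamma> s) - grad f (\<gamma> t)) \<le> L * (M * \<tau>)" if "s \<in> ?I" for s
      using lip[of "\<gamma> s" "\<gamma> t"] mult_left_mono[OF speed[OF that], of L] \<open>L > 0\<close> by linarith
  qed (use der \<open>\<tau> \<ge> 0\<close> in \<open>auto simp: closed_segment_eq_real_ivl\<close>)
  then show ?thesis using \<open>\<tau> \<ge> 0\<close> by simp
qed

text \<open>
  Two estimates in one: \<open>\<sigma> = 1\<close> bounds the distance to the critical point \<open>p\<close> backward in time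
  and \<open>\<sigma> = -1\<close> forward in time. Both hold because the squared distance changes at a rate of at
  most \<open>2 L\<close> times itself.
\<close>

lemma flow_Gronwall:
  fixes f :: "real ^ 'n \<Rightarrow> real"
  assumes flow: "gradient_flow_line f x0 \<gamma>"
    and lip: "\<And>x y. norm (grad f x - grad f y) \<le> L * norm (x - y)"
    and crit: "grad f p = 0" and st: "0 \<le> s" "s \<le> t" and \<sigma>: "\<sigma> = 1 \<or> \<sigma> = -1"
  shows "\<sigma> * exp (2 * L * \<sigma> * s) * (norm (\<gamma> s - p))\<^sup>2 \<le> \<sigma> * exp (2 * L * \<sigma> * t) * (norm (\<gamma> t - p))\<^sup>2"
proof -
  define w where "w r = (\<gamma> r - p) \<bullet> (\<gamma> r - p)" for r
  define w' where "w' r = 2 * ((\<gamma> r - p) \<bullet> grad f (\<gamma> r))" for r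
  let ?h = "\<lambda>r. \<sigma> * exp (2 * L * \<sigma> * r) * w r"
  have der: "(?h has_derivative (\<lambda>v. v * (exp (2 * L * \<sigma> * r) * (\<sigma> * w' r + 2 * L * w r))))
      (at r within {s..t})" if "s \<le> r" "r \<le> t" for r
  proof -
    have "(\<gamma> has_derivative (\<lambda>v. v *\<^sub>R grad f (\<gamma> r))) (at r within {s..t})"
      using flow that st unfolding gradient_flow_line_def has_vector_derivative_def
      by (intro has_derivative_subset[where s = "{0..}" and t = "{s..t}"]) auto
    note [derivative_intros] = this
    have "\<sigma> * \<sigma> = 1" using \<sigma> by auto
    then have *: "\<sigma> * (\<sigma> * z) = z" for z by (metis mult.assoc mult_1)
    show ?thesis
      unfolding w_def w'_def
      by (auto intro!: derivative_eq_intros simp: fun_eq_iff algebra_simps inner_commute *)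
  qed
  have nonneg: "\<sigma> * w' r + 2 * L * w r \<ge> 0" for r
  proof -
    have "\<bar>(\<gamma> r - p) \<bullet> grad f (\<gamma> r)\<bar> \<le> norm (\<gamma> r - p) * norm (grad f (\<gamma> r))"
      by (rule Cauchy_Schwarz_ineq2)
    also have "\<dots> \<le> norm (\<gamma> r - p) * (L * norm (\<gamma> r - p))"
      using lip[of "\<gamma> r" p] crit by (intro mult_left_mono) auto
    also have "\<dots> = L * w r"
      by (simp add: w_def dot_square_norm power2_eq_square)
    finally have "\<bar>w' r\<bar> \<le> 2 * L * w r" by (simp add: w'_def abs_mult)
    then show ?thesis using \<sigma> by auto
  qed
  obtain r where "?h t - ?h s = (t - s) * (exp (2 * L * \<sigma> * r) * (\<sigma> * w' r + 2 * L * w r))"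
    using mvt_very_simple[OF st(2) der] by blast
  also have "\<dots> \<ge> 0" using st nonneg by (intro mult_nonneg_nonneg) auto
  finally show ?thesis by (simp add: w_def dot_square_norm)
qed

lemma flow_through_critical_point_constant:
  fixes f :: "real ^ 'n \<Rightarrow> real"
  assumes flow: "gradient_flow_line f x0 \<gamma>"
    and lip: "\<And>x y. norm (grad f x - grad f y) \<le> L * norm (x - y)"
    and crit: "grad f (\<gamma> s) = 0" and "s \<ge> 0" "t \<ge> 0"
  shows "\<gamma> t = \<gamma> s"
proof (cases "s \<le> t")
  case True
  have "exp (2 * L * (-1) * t) * (norm (\<gamma> t - \<gamma> s))\<^sup>2 \<le> 0"
    using flow_Gronwall[OF flow lip crit \<open>s \<ge> 0\<close> True, of "-1"] by simp
  then show ?thesis by (simp add: mult_le_0_iff)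
next
  case False
  have "exp (2 * L * t) * (norm (\<gamma> t - \<gamma> s))\<^sup>2 \<le> 0"
    using flow_Gronwall[OF flow lip crit \<open>t \<ge> 0\<close>, of s 1] False by simp
  then show ?thesis by (simp add: mult_le_0_iff)
qed

lemma convergent_flow_not_critical:
  fixes f :: "real ^ 'n \<Rightarrow> real"
  assumes flow: "gradient_flow_line f x0 \<gamma>" and lim: "(\<gamma> \<longlongrightarrow> xs) at_top"
    and lip: "\<And>x y. norm (grad f x - grad f y) \<le> L * norm (x - y)"
    and "x0 \<noteq> xs" "t \<ge> 0"
  shows "grad f (\<gamma> t) \<noteq> 0"
proof
  assume crit: "grad f (\<gamma> t) = 0"
  have const: "\<gamma> s = \<gamma> t" if "s \<ge> 0" for s
    using flow_through_critical_point_constant[OF flow lip crit \<open>t \<ge> 0\<close> that] .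
  have "eventually (\<lambda>s. \<gamma> t = \<gamma> s) at_top"
    using eventually_ge_at_top[of 0] by eventually_elim (simp add: const)
  then have "(\<gamma> \<longlongrightarrow> \<gamma> t) at_top"
    by (rule Lim_transform_eventually[OF tendsto_const])
  then have "\<gamma> t = xs" using lim by (metis tendsto_unique trivial_limit_at_top_linorder)
  moreover have "x0 = \<gamma> t" using const[of 0] flow by (simp add: gradient_flow_line_def)
  ultimately show False using \<open>x0 \<noteq> xs\<close> by simp
qed


section \<open>Max Shift follows the flow\<close>

text \<open>
  Step \<open>k\<close> is matched with the flow time \<open>tt k\<close>, the sum of the Euler step sizes so far. The
  error obeys \<open>E' \<le> (1 + L \<tau>) E + \<tau> \<kappa>\<close>, whence \<open>E \<le> \<kappa> / L * (exp (L t) - 1)\<close>; here \<open>\<kappa>\<close> adds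
  the deviation of the maximizer and the Euler error of the flow. The induction also has to
  carry the lower bound \<open>c\<close> on the gradient along the iterates, which holds as long as they stay
  within \<open>c / L\<close> of the flow line. The condition \<open>\<epsilon> \<le> c\<close> keeps time steps below 1, so that the
  first matched time beyond \<open>T\<close> is still in the range where the lower bound is available.
\<close>

lemma max_shift_tracks_flow:
  fixes f :: "real ^ 'n \<Rightarrow> real"
  assumes der: "\<And>x. (f has_derivative (\<lambda>h. h \<bullet> grad f x)) (at x)"
    and lip: "\<And>x y. norm (grad f x - grad f y) \<le> L * norm (x - y)" and L: "L > 0"
    and bd: "\<And>x. norm (grad f x) \<le> M"
    and flow: "gradient_flow_line f x0 \<gamma>"
    and x0: "x 0 = x0"
    and step: "\<And>k. is_arg_max f (\<lambda>y. y \<in> cball (x k) \<epsilon>) (x (Suc k))"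
    and c: "c > 0" "\<And>t. 0 \<le> t \<Longrightarrow> t \<le> T + 1 \<Longrightarrow> 2 * c \<le> norm (grad f (\<gamma> t))"
    and T: "T \<ge> 0" and \<epsilon>: "0 < \<epsilon>" "\<epsilon> \<le> c"
    and small: "(sqrt (4 * L * M * \<epsilon>) + L * M * \<epsilon> / c) * exp (L * (T + 1)) \<le> L * \<delta>"
    and \<delta>: "L * \<delta> \<le> c"
  shows "\<exists>k t. T \<le> t \<and> norm (x k - \<gamma> t) \<le> \<delta> \<and> (\<forall>j<k. grad f (x j) \<noteq> 0)"
proof -
  define \<kappa> where "\<kappa> = sqrt (4 * L * M * \<epsilon>) + L * M * \<epsilon> / c"
  define \<tau> where "\<tau> k = \<epsilon> / norm (grad f (x k))" for k
  define tt where "tt k = (\<Sum>j<k. \<tau> j)" for k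
  have M: "M > 0" using c(2)[of 0] c(1) T bd[of "\<gamma> 0"] by linarith
  have \<kappa>: "\<kappa> \<ge> 0" using M L c(1) \<epsilon> by (simp add: \<kappa>_def)
  have tau0: "\<tau> k \<ge> 0" for k using \<epsilon> by (simp add: \<tau>_def)
  have tt0: "tt k \<ge> 0" for k by (simp add: tt_def sum_nonneg tau0)
  have ttSuc: "tt (Suc k) = tt k + \<tau> k" for k by (simp add: tt_def)
  have close: "norm (y - \<gamma> t) \<le> \<delta> \<and> c \<le> norm (grad f y)"
    if "0 \<le> t" "t \<le> T + 1" "norm (y - \<gamma> t) \<le> \<kappa> / L * (exp (L * t) - 1)" for y t
  proof -
    have "L * norm (y - \<gamma> t) \<le> \<kappa> * (exp (L * t) - 1)"
      using that(3) L by (simp add: field_simps)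
    also have "\<dots> \<le> \<kappa> * exp (L * (T + 1))"
    proof (rule mult_left_mono[OF _ \<kappa>])
      have "exp (L * t) \<le> exp (L * (T + 1))" using that L by simp
      then show "exp (L * t) - 1 \<le> exp (L * (T + 1))" by linarith
    qed
    also have "\<dots> \<le> L * \<delta>" using small by (simp add: \<kappa>_def)
    finally have *: "L * norm (y - \<gamma> t) \<le> L * \<delta>" .
    have "norm (grad f (\<gamma> t)) - norm (grad f y) \<le> norm (grad f y - grad f (\<gamma> t))"
      by (metis norm_minus_commute norm_triangle_ineq2)
    then have "c \<le> norm (grad f y)"
      using c(2)[OF that(1,2)] lip[of y "\<gamma> t"] * \<delta> by linarith
    then show ?thesis using * L by simp
  qed
  have track: "norm (x k - \<gamma> (tt k)) \<le> \<kappa> / L * (exp (L * tt k) - 1)" if "tt k \<le> T + 1" for k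
    using that
  proof (induction k)
    case 0
    then show ?case using x0 flow by (simp add: tt_def gradient_flow_line_def)
  next
    case (Suc k)
    define t where "t = tt k"
    have t: "0 \<le> t" "t \<le> T + 1" using Suc.prems tau0[of k] tt0 by (auto simp: t_def ttSuc)
    have IH: "norm (x k - \<gamma> t) \<le> \<kappa> / L * (exp (L * t) - 1)"
      using Suc.IH t by (simp add: t_def)
    have g: "c \<le> norm (grad f (x k))" using close[OF t IH] by simp
    then have gn: "grad f (x k) \<noteq> 0" using c(1) by auto
    have "\<tau> k \<le> \<epsilon> / c" using g c(1) \<epsilon> by (simp add: \<tau>_def frac_le)
    then have b: "L * (M * \<tau> k) \<le> L * M * \<epsilon> / c"
      using mult_left_mono[of "\<tau> k" "\<epsilon> / c" "L * M"] L M by (simp add: mult.assoc)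
    have a: "sqrt (4 * L * \<epsilon> * norm (grad f (x k))) \<le> sqrt (4 * L * M * \<epsilon>)"
      using bd[of "x k"] L \<epsilon> by simp
    let ?e = "x (Suc k) - x k - \<tau> k *\<^sub>R grad f (x k)"
    let ?r = "\<gamma> (t + \<tau> k) - \<gamma> t - \<tau> k *\<^sub>R grad f (\<gamma> t)"
    have "norm ?e \<le> \<tau> k * sqrt (4 * L * \<epsilon> * norm (grad f (x k)))"
      unfolding \<tau>_def by (rule arg_max_step_Euler[OF der lip L step \<epsilon>(1) gn])
    also have "\<dots> \<le> \<tau> k * sqrt (4 * L * M * \<epsilon>)" by (rule mult_left_mono[OF a tau0])
    finally have e: "norm ?e \<le> \<tau> k * sqrt (4 * L * M * \<epsilon>)" .
    have "norm ?r \<le> \<tau> k * (L * (M * \<tau> k))"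
      by (rule flow_Euler_error[OF flow lip L bd t(1) tau0])
    also have "\<dots> \<le> \<tau> k * (L * M * \<epsilon> / c)" by (rule mult_left_mono[OF b tau0])
    finally have r: "norm ?r \<le> \<tau> k * (L * M * \<epsilon> / c)" .
    have "x (Suc k) - \<gamma> (t + \<tau> k)
        = (x k - \<gamma> t) + \<tau> k *\<^sub>R (grad f (x k) - grad f (\<gamma> t)) + (?e - ?r)"
      by (simp add: algebra_simps)
    also have "norm \<dots> \<le> norm (x k - \<gamma> t) + norm (\<tau> k *\<^sub>R (grad f (x k) - grad f (\<gamma> t))) + (norm ?e + norm ?r)"
      by (intro norm_triangle_mono norm_triangle_ineq4 order_refl)
    also have "\<dots> \<le> norm (x k - \<gamma> t) + \<tau> k * (L * norm (x k - \<gamma> t)) + \<tau> k * \<kappa>"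
    proof -
      have "norm (\<tau> k *\<^sub>R (grad f (x k) - grad f (\<gamma> t))) \<le> \<tau> k * (L * norm (x k - \<gamma> t))"
        using mult_left_mono[OF lip[of "x k" "\<gamma> t"] tau0[of k]] tau0[of k] by simp
      moreover have "\<tau> k * \<kappa> = \<tau> k * sqrt (4 * L * M * \<epsilon>) + \<tau> k * (L * M * \<epsilon> / c)"
        unfolding \<kappa>_def by (rule distrib_left)
      ultimately show ?thesis using e r by linarith
    qed
    also have "\<dots> = (1 + L * \<tau> k) * norm (x k - \<gamma> t) + \<tau> k * \<kappa>"
      by (simp add: algebra_simps)
    also have "\<dots> \<le> (1 + L * \<tau> k) * (\<kappa> / L * (exp (L * t) - 1)) + \<tau> k * \<kappa>"
      using IH L tau0[of k] by (intro add_right_mono mult_left_mono) auto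
    also have "\<dots> = \<kappa> / L * ((1 + L * \<tau> k) * exp (L * t) - 1)"
      using L by (simp add: field_simps)
    also have "\<dots> \<le> \<kappa> / L * (exp (L * \<tau> k) * exp (L * t) - 1)"
      using \<kappa> L by (intro mult_left_mono diff_right_mono mult_right_mono exp_ge_add_one_self) auto
    finally show ?case
      by (simp add: ttSuc t_def exp_add[symmetric] distrib_left add.commute)
  qed
  have near: "norm (x k - \<gamma> (tt k)) \<le> \<delta>" "c \<le> norm (grad f (x k))" if "tt k \<le> T + 1" for k
    using close[OF tt0 that track[OF that]] by auto
  have "\<exists>k. T \<le> tt k"
  proof (rule ccontr)
    assume "\<not> ?thesis"
    then have below: "tt k < T" for k by (simp add: not_le)
    have lower: "real k * (\<epsilon> / M) \<le> tt k" for k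
    proof (induction k)
      case (Suc k)
      have "0 < norm (grad f (x k))" using near(2)[of k] below[of k] c(1) by linarith
      then have "\<epsilon> / M \<le> \<tau> k"
        unfolding \<tau>_def using bd[of "x k"] \<epsilon> M by (intro divide_left_mono) auto
      then show ?case using Suc.IH by (simp add: ttSuc algebra_simps)
    qed (simp add: tt0)
    obtain k :: nat where "T < real k * (\<epsilon> / M)"
      using ex_less_of_nat_mult[of "\<epsilon> / M" T] \<epsilon> M by auto
    then show False using lower[of k] below[of k] by linarith
  qed
  then obtain k where k: "T \<le> tt k" and least: "\<And>j. j < k \<Longrightarrow> tt j < T"
    using exists_least_iff[of "\<lambda>k. T \<le> tt k"] by (auto simp: not_le)
  have "tt k \<le> T + 1"
  proof (cases k)
    case 0
    then show ?thesis using T by (simp add: tt_def)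
  next
    case (Suc j)
    then have j: "tt j < T" using least by simp
    then have "c \<le> norm (grad f (x j))" using near(2)[of j] by simp
    then have "\<tau> j \<le> 1" using c(1) \<epsilon> by (simp add: \<tau>_def divide_le_eq_1)
    then show ?thesis using j by (simp add: Suc ttSuc)
  qed
  moreover have "grad f (x j) \<noteq> 0" if "j < k" for j
    using near(2)[of j] least[OF that] c(1) by auto
  ultimately show ?thesis using k near(1) by blast
qed

section \<open>Max Shift near a mode\<close>

lemma invertible_derivative_isolated_zero:
  fixes g :: "real ^ 'n \<Rightarrow> real ^ 'n"
  assumes der: "(g has_derivative (*v) A) (at x)" and inv: "invertible A" and zero: "g x = 0"
  obtains d where "d > 0" "\<And>y. dist x y < d \<Longrightarrow> g y = 0 \<Longrightarrow> y = x"
proof -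
  obtain B where B: "B > 0" "\<And>h. B * norm h \<le> norm (A *v h)"
    using linear_inj_bounded_below_pos[OF matrix_vector_mul_linear inj_matrix_vector_mult[OF inv]]
    by blast
  obtain d where d: "d > 0"
    "\<And>y. norm (y - x) < d \<Longrightarrow> norm (g y - g x - A *v (y - x)) \<le> B / 2 * norm (y - x)"
    using der B(1) unfolding has_derivative_at_alt by (meson half_gt_zero)
  have "y = x" if "dist x y < d" "g y = 0" for y
  proof -
    have "norm (A *v (y - x)) \<le> B / 2 * norm (y - x)"
      using d(2)[of y] that zero by (simp add: dist_norm norm_minus_commute)
    then have "B * norm (y - x) \<le> B / 2 * norm (y - x)" using B(2) order_trans by blast
    then show ?thesis using B(1) by (simp add: field_simps)
  qed
  then show thesis using that d(1) by blast
qed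

text \<open>
  Strictness needs no second-order expansion: a point near \<open>xs\<close> with the same value would itself
  be a local maximum, hence a second critical point near \<open>xs\<close>. The annulus is thick enough that
  steps of length at most \<open>\<rho> / 2\<close> cannot jump over it.
\<close>

lemma mode_well:
  fixes f :: "real ^ 'n \<Rightarrow> real"
  assumes reg: "regular_density f" and mode: "is_mode f xs"
  obtains \<rho> m where "\<rho> > 0" "m < f xs"
    "\<And>y. y \<in> cball xs \<rho> \<Longrightarrow> grad f y = 0 \<Longrightarrow> y = xs"
    "\<And>y. \<rho> / 2 \<le> dist xs y \<Longrightarrow> dist xs y \<le> \<rho> \<Longrightarrow> f y \<le> m"
proof -
  have der: "(f has_derivative (\<lambda>h. h \<bullet> grad f x)) (at x)" for x
    by (rule regular_has_derivative[OF reg])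
  have cont: "continuous_on A f" for A
    using der by (meson continuous_at_imp_continuous_on has_derivative_continuous)
  obtain r where r: "r > 0" "\<forall>y\<in>ball xs r. f y \<le> f xs"
    using mode by (auto simp: is_mode_def)
  have crit: "grad f xs = 0" by (rule local_max_critical[OF der r])
  then have "invertible (hessian f xs)"
    using reg by (simp add: regular_density_def critical_point_def)
  then obtain d where d: "d > 0" "\<And>y. dist xs y < d \<Longrightarrow> grad f y = 0 \<Longrightarrow> y = xs"
    using invertible_derivative_isolated_zero[of "grad f" "hessian f xs" xs]
      regular_has_derivative_grad[OF reg, of xs] crit by blast
  define \<rho> where "\<rho> = min r d / 2"
  have \<rho>: "\<rho> > 0" "\<rho> < r" "\<rho> < d" using r(1) d(1) by (auto simp: \<rho>_def)
  have strict: "f y < f xs" if "dist xs y < r" "dist xs y < d" "y \<noteq> xs" for y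
  proof (rule ccontr)
    assume "\<not> ?thesis"
    then have "\<forall>z\<in>ball xs r. f z \<le> f y" using r(2) by fastforce
    moreover have "ball y (r - dist xs y) \<subseteq> ball xs r"
      by (metis add.commute ball_subset_ball_iff diff_add_cancel dist_commute order_refl)
    ultimately have "grad f y = 0"
      using local_max_critical[OF der, of "r - dist xs y" y] that(1) by auto
    then show False using d(2) that by blast
  qed
  let ?A = "cball xs \<rho> - ball xs (\<rho> / 2)"
  obtain m where m: "m < f xs" "\<And>y. y \<in> ?A \<Longrightarrow> f y \<le> m"
  proof (cases "?A = {}")
    case True
    show thesis using that[of "f xs - 1", unfolded True] by simp
  next
    case False
    have "compact ?A" by (intro compact_diff compact_cball open_ball)
    then obtain z where z: "z \<in> ?A" "\<And>y. y \<in> ?A \<Longrightarrow> f y \<le> f z"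
      using continuous_attains_sup[OF _ False cont] by blast
    moreover have "f z < f xs" using z(1) \<rho> by (intro strict) auto
    ultimately show thesis using that by blast
  qed
  show thesis
  proof (rule that[OF \<rho>(1) m(1)])
    show "y = xs" if "y \<in> cball xs \<rho>" "grad f y = 0" for y
      using d(2) that \<rho> by auto
    show "f y \<le> m" if "\<rho> / 2 \<le> dist xs y" "dist xs y \<le> \<rho>" for y
      using m(2) that by auto
  qed
qed

lemma arg_max_sequence_trapped:
  fixes f :: "'a::metric_space \<Rightarrow> real"
  assumes step: "\<And>k. is_arg_max f (\<lambda>y. y \<in> cball (x k) \<epsilon>) (x (Suc k))"
    and \<epsilon>: "0 < \<epsilon>" "\<epsilon> \<le> \<rho> / 2"
    and annulus: "\<And>y. \<rho> / 2 \<le> dist xs y \<Longrightarrow> dist xs y \<le> \<rho> \<Longrightarrow> f y \<le> m"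
    and start: "x K \<in> ball xs (\<rho> / 2)" "m < f (x K)" and "K \<le> k"
  shows "x k \<in> ball xs (\<rho> / 2)"
proof -
  have "x k \<in> ball xs (\<rho> / 2) \<and> m < f (x k)"
    using \<open>K \<le> k\<close>
  proof (induction rule: dec_induct)
    case (step k)
    have s: "dist (x k) (x (Suc k)) \<le> \<epsilon>" "f (x k) \<le> f (x (Suc k))"
      using assms(1)[of k] \<epsilon>(1) by (auto simp: is_arg_max_linorder)
    then have "m < f (x (Suc k))" using step by simp
    moreover have "dist xs (x (Suc k)) \<le> \<rho>"
      using dist_triangle[of xs "x (Suc k)" "x k"] s(1) step \<epsilon>(2) by (auto simp: dist_commute)
    ultimately show ?case using annulus[of "x (Suc k)"] by fastforce
  qed (use start in auto)
  then show ?thesis ..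
qed

text \<open>
  Away from \<open>xs\<close> the gradient is bounded below by compactness, so an iterate there gains a fixed
  amount of \<open>f\<close>; but the increments of a bounded monotone sequence tend to 0.
\<close>

lemma arg_max_sequence_converges:
  fixes f :: "real ^ 'n \<Rightarrow> real"
  assumes der: "\<And>x. (f has_derivative (\<lambda>h. h \<bullet> grad f x)) (at x)"
    and lip: "\<And>x y. norm (grad f x - grad f y) \<le> L * norm (x - y)" and L: "L > 0"
    and bdf: "\<And>y. f y \<le> B"
    and step: "\<And>k. is_arg_max f (\<lambda>y. y \<in> cball (x k) \<epsilon>) (x (Suc k))" and \<epsilon>: "\<epsilon> > 0"
    and crit: "\<And>y. y \<in> cball xs \<rho> \<Longrightarrow> grad f y = 0 \<Longrightarrow> y = xs"
    and trapped: "\<And>k. K \<le> k \<Longrightarrow> x k \<in> cball xs \<rho>"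
  shows "x \<longlonglongrightarrow> xs"
proof (rule metric_LIMSEQ_I)
  fix e :: real
  assume "e > 0"
  let ?A = "cball xs \<rho> - ball xs e"
  have "L-lipschitz_on ?A (grad f)"
    using lip L by (intro lipschitz_onI) (auto simp: dist_norm)
  then have cont: "continuous_on ?A (\<lambda>y. norm (grad f y))"
    by (intro continuous_on_norm lipschitz_on_continuous_on)
  obtain c where c: "c > 0" "\<And>y. y \<in> ?A \<Longrightarrow> c \<le> norm (grad f y)"
  proof (cases "?A = {}")
    case True
    show thesis using that[of 1, unfolded True] by simp
  next
    case False
    have "compact ?A" by (intro compact_diff compact_cball open_ball)
    then obtain z where z: "z \<in> ?A" "\<And>y. y \<in> ?A \<Longrightarrow> norm (grad f z) \<le> norm (grad f y)"
      using continuous_attains_inf[OF _ False cont] by blast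
    have "grad f z \<noteq> 0" using crit[of z] z(1) \<open>e > 0\<close> by auto
    then show thesis using that[of "norm (grad f z)"] z(2) by simp
  qed
  \<comment> \<open>\<open>c / (2 * L)\<close> maximizes the guaranteed gain \<open>s * c - L * s\<^sup>2\<close>.\<close>
  define s where "s = min \<epsilon> (c / (2 * L))"
  have s: "0 < s" "s \<le> \<epsilon>" "s * L \<le> c / 2"
    using \<epsilon> c(1) L by (auto simp: s_def field_simps min_def)
  have gain: "f y + s * c / 2 \<le> f y'"
    if "y \<in> ?A" "is_arg_max f (\<lambda>z. z \<in> cball y \<epsilon>) y'" for y y'
  proof -
    have "grad f y \<noteq> 0" using c that(1) by fastforce
    then have "f y + s * norm (grad f y) - L * s\<^sup>2 \<le> f y'"
      using ascent_along_gradient[of f L y \<epsilon> y' s, OF der lip L that(2)] s by simp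
    moreover have "s * c \<le> s * norm (grad f y)" using c(2)[OF that(1)] s by simp
    moreover have "L * s\<^sup>2 \<le> s * c / 2"
      using mult_left_mono[OF s(3), of s] s(1) by (simp add: power2_eq_square mult_ac)
    ultimately show ?thesis by linarith
  qed
  have "incseq (\<lambda>k. f (x k))"
    using step \<epsilon> by (intro incseq_SucI) (force simp: is_arg_max_linorder)
  then obtain F where F: "(\<lambda>k. f (x k)) \<longlonglongrightarrow> F"
    using incseq_convergent[of "\<lambda>k. f (x k)" B] bdf by blast
  have "(\<lambda>k. f (x (Suc k)) - f (x k)) \<longlonglongrightarrow> F - F"
    by (intro tendsto_diff F LIMSEQ_Suc[OF F])
  then have "eventually (\<lambda>k. f (x (Suc k)) - f (x k) < s * c / 2) sequentially"
    by (rule order_tendstoD) (use s c in simp)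
  then obtain N where N: "\<And>k. N \<le> k \<Longrightarrow> f (x (Suc k)) - f (x k) < s * c / 2"
    by (auto simp: eventually_sequentially)
  have "dist (x k) xs < e" if "max N K \<le> k" for k
  proof (rule ccontr)
    assume "\<not> ?thesis"
    then have "x k \<in> ?A" using trapped[of k] that by (auto simp: dist_commute)
    then show False using gain[OF _ step[of k]] N[of k] that by force
  qed
  then show "\<exists>N. \<forall>k\<ge>N. dist (x k) xs < e" by blast
qed

lemma max_shift_converges_from_trap:
  fixes f :: "real ^ 'n \<Rightarrow> real"
  assumes der: "\<And>x. (f has_derivative (\<lambda>h. h \<bullet> grad f x)) (at x)"
    and lip: "\<And>x y. norm (grad f x - grad f y) \<le> L * norm (x - y)" and L: "L > 0"
    and bdf: "\<And>y. f y \<le> B"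
    and step: "\<And>k. is_arg_max f (\<lambda>y. y \<in> cball (x k) \<epsilon>) (x (Suc k))"
    and \<epsilon>: "0 < \<epsilon>" "\<epsilon> \<le> \<rho> / 2"
    and crit: "\<And>y. y \<in> cball xs \<rho> \<Longrightarrow> grad f y = 0 \<Longrightarrow> y = xs"
    and annulus: "\<And>y. \<rho> / 2 \<le> dist xs y \<Longrightarrow> dist xs y \<le> \<rho> \<Longrightarrow> f y \<le> m"
    and start: "x K \<in> ball xs (\<rho> / 2)" "m < f (x K)"
    and before: "\<And>j. j < K \<Longrightarrow> grad f (x j) \<noteq> 0"
  shows "process_converges f x xs"
proof -
  have trapped: "x k \<in> cball xs \<rho>" if "K \<le> k" for k
    using arg_max_sequence_trapped[OF step \<epsilon> annulus start that] \<epsilon> by simp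
  have "x k = xs" if "stops_at f x k" for k
  proof -
    have "\<forall>y\<in>ball (x k) \<epsilon>. f y \<le> f (x k)"
      using that step[of k] by (auto simp: stops_at_def is_arg_max_linorder)
    then have g: "grad f (x k) = 0" by (rule local_max_critical[OF der \<epsilon>(1)])
    then have "K \<le> k" using before not_le by blast
    then show ?thesis using crit trapped g by blast
  qed
  moreover have "x \<longlonglongrightarrow> xs"
    by (rule arg_max_sequence_converges[of f L B x \<epsilon> xs \<rho> K, OF der lip L bdf step \<epsilon>(1) crit trapped])
  ultimately show ?thesis by (auto simp: process_converges_def)
qed

section \<open>Consistency\<close>

theorem mainTheorem3:
  fixes f :: "real ^ 'n \<Rightarrow> real"
    and S :: "real \<Rightarrow> real ^ 'n \<Rightarrow> real ^ 'n"
    and xs x0 :: "real ^ 'n"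
  assumes "regular_density f"
    and "max_shift_rule f S"
    and "is_mode f xs"
    and "x0 \<in> basin f xs"
  shows "\<exists>\<epsilon>0>0. \<forall>\<epsilon>. 0 < \<epsilon> \<and> \<epsilon> \<le> \<epsilon>0 \<longrightarrow>
           process_converges f (max_shift S \<epsilon> x0) xs"
proof -
  have der: "(f has_derivative (\<lambda>h. h \<bullet> grad f x)) (at x)" for x
    by (rule regular_has_derivative[OF assms(1)])
  obtain L where L: "L > 0" and lip: "\<And>x y. norm (grad f x - grad f y) \<le> L * norm (x - y)"
    using regular_grad_Lipschitz[OF assms(1)] by blast
  have "bounded (range f)" "bounded (range (grad f))"
    using assms(1) by (auto simp: regular_density_def bounded_unif_cont_def)
  then obtain B M where "\<And>y. \<bar>f y\<bar> \<le> B" and bd: "\<And>y. norm (grad f y) \<le> M"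
    by (auto simp: bounded_iff)
  then have bdf: "f y \<le> B" for y using abs_le_D1 by blast
  have step: "is_arg_max f (\<lambda>y. y \<in> cball (max_shift S \<epsilon> x0 k) \<epsilon>) (max_shift S \<epsilon> x0 (Suc k))"
    if "\<epsilon> > 0" for \<epsilon> k
    using assms(2) that by (simp add: max_shift_rule_def)
  obtain \<rho> m where \<rho>: "\<rho> > 0" and m: "m < f xs"
    and crit: "\<And>y. y \<in> cball xs \<rho> \<Longrightarrow> grad f y = 0 \<Longrightarrow> y = xs"
    and annulus: "\<And>y. \<rho> / 2 \<le> dist xs y \<Longrightarrow> dist xs y \<le> \<rho> \<Longrightarrow> f y \<le> m"
    using mode_well[OF assms(1,3)] by blast
  have finish: "process_converges f (max_shift S \<epsilon> x0) xs"
    if "0 < \<epsilon>" "\<epsilon> \<le> \<rho> / 2" "max_shift S \<epsilon> x0 K \<in> ball xs (\<rho> / 2)" "m < f (max_shift S \<epsilon> x0 K)"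
      "\<forall>j<K. grad f (max_shift S \<epsilon> x0 j) \<noteq> 0" for \<epsilon> K
    using max_shift_converges_from_trap[of f L B "max_shift S \<epsilon> x0" \<epsilon> \<rho> xs m K, OF der lip L bdf step[OF that(1)] that(1,2) crit annulus that(3,4)]
      that(5) by blast
  show ?thesis
  proof (cases "x0 = xs")
    case True
    have "process_converges f (max_shift S \<epsilon> x0) xs" if "0 < \<epsilon> \<and> \<epsilon> \<le> \<rho> / 2" for \<epsilon>
      by (rule finish[of \<epsilon> 0]) (use that True m \<rho> in auto)
    then show ?thesis using \<rho> half_gt_zero by blast
  next
    case False
    obtain \<gamma> where flow: "gradient_flow_line f x0 \<gamma>" and lim: "(\<gamma> \<longlongrightarrow> xs) at_top"
      using assms(4) by (auto simp: basin_def)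
    have "isCont f xs" using der has_derivative_continuous by blast
    then have "eventually (\<lambda>y. m < f y) (nhds xs)"
      using m order_tendstoD(1) by (metis isCont_def tendsto_at_iff_tendsto_nhds)
    then obtain d where d: "d > 0" "\<And>y. dist y xs < d \<Longrightarrow> m < f y"
      by (auto simp: eventually_nhds_metric)
    define \<sigma> where "\<sigma> = min d (\<rho> / 2)"
    have \<sigma>: "\<sigma> > 0" using d(1) \<rho> by (simp add: \<sigma>_def)
    have "eventually (\<lambda>t. dist (\<gamma> t) xs < \<sigma> / 2) at_top"
      by (rule tendstoD[OF lim]) (use \<sigma> in simp)
    then obtain T0 where T0: "\<And>t. T0 \<le> t \<Longrightarrow> dist (\<gamma> t) xs < \<sigma> / 2"
      by (auto simp: eventually_at_top_linorder)
    define T where "T = max 0 T0"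
    have T: "T \<ge> 0" "\<And>t. T \<le> t \<Longrightarrow> dist (\<gamma> t) xs < \<sigma> / 2" using T0 by (auto simp: T_def)
    have "continuous_on {0..} \<gamma>"
      using flow unfolding gradient_flow_line_def
      by (meson atLeast_iff continuous_on_eq_continuous_within has_vector_derivative_continuous)
    then have "continuous_on {0..T + 1} \<gamma>" by (rule continuous_on_subset) auto
    moreover have "continuous_on (\<gamma> ` {0..T + 1}) (grad f)"
      using assms(1) uniformly_continuous_imp_continuous[of UNIV "grad f"]
      by (auto simp: regular_density_def bounded_unif_cont_def intro: continuous_on_subset)
    ultimately have "continuous_on {0..T + 1} (\<lambda>t. norm (grad f (\<gamma> t)))"
      by (intro continuous_on_norm continuous_on_compose2[where g = "grad f" and f = \<gamma>]) auto
    then obtain u where u: "u \<in> {0..T + 1}"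
      "\<And>t. t \<in> {0..T + 1} \<Longrightarrow> norm (grad f (\<gamma> u)) \<le> norm (grad f (\<gamma> t))"
      using continuous_attains_inf[of "{0..T + 1}" "\<lambda>t. norm (grad f (\<gamma> t))"] T(1) by auto
    define c where "c = norm (grad f (\<gamma> u)) / 2"
    have c: "c > 0"
      using convergent_flow_not_critical[OF flow lim lip False, of u] u(1) by (simp add: c_def)
    have cle: "2 * c \<le> norm (grad f (\<gamma> t))" if "0 \<le> t" "t \<le> T + 1" for t
      using u(2) that by (simp add: c_def)
    define \<delta> where "\<delta> = min (\<sigma> / 2) (c / L)"
    have \<delta>: "\<delta> > 0" "\<delta> \<le> \<sigma> / 2" "L * \<delta> \<le> c"
      using \<sigma> c L by (auto simp: \<delta>_def min_def field_simps)
    let ?err = "\<lambda>\<epsilon>. (sqrt (4 * L * M * \<epsilon>) + L * M * \<epsilon> / c) * exp (L * (T + 1))"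
    have "(?err \<longlongrightarrow> (sqrt (4 * L * M * 0) + L * M * 0 / c) * exp (L * (T + 1))) (at_right 0)"
      using c by (intro tendsto_intros) auto
    then have "eventually (\<lambda>\<epsilon>. ?err \<epsilon> < L * \<delta>) (at_right 0)"
      by (rule order_tendstoD) (use L \<delta>(1) in simp)
    then obtain b where b: "b > 0" "\<And>\<epsilon>. 0 < \<epsilon> \<Longrightarrow> \<epsilon> < b \<Longrightarrow> ?err \<epsilon> < L * \<delta>"
      by (auto simp: eventually_at_right_field)
    define \<epsilon>0 where "\<epsilon>0 = min (b / 2) (min c (\<rho> / 2))"
    have "process_converges f (max_shift S \<epsilon> x0) xs" if \<epsilon>: "0 < \<epsilon> \<and> \<epsilon> \<le> \<epsilon>0" for \<epsilon>
    proof -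
      let ?x = "max_shift S \<epsilon> x0"
      have e: "0 < \<epsilon>" "\<epsilon> \<le> c" "\<epsilon> \<le> \<rho> / 2" "?err \<epsilon> \<le> L * \<delta>"
        using \<epsilon> b by (auto simp: \<epsilon>0_def intro!: less_imp_le b(2))
      obtain k t where k: "T \<le> t" "norm (?x k - \<gamma> t) \<le> \<delta>" "\<forall>j<k. grad f (?x j) \<noteq> 0"
        using max_shift_tracks_flow[of f L M x0 \<gamma> ?x \<epsilon> c T \<delta>,
            OF der lip L bd flow _ step[OF e(1)] c cle T(1) e(1,2,4) \<delta>(3)] by auto
      have "dist (?x k) xs < \<sigma>"
        using dist_triangle[of "?x k" xs "\<gamma> t"] T(2)[OF k(1)] k(2) \<delta>(2) by (simp add: dist_norm)
      then have "?x k \<in> ball xs (\<rho> / 2)" "m < f (?x k)"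
        using d(2) by (auto simp: \<sigma>_def dist_commute)
      then show ?thesis using finish e k(3) by blast
    qed
    moreover have "\<epsilon>0 > 0" using b(1) c \<rho> by (simp add: \<epsilon>0_def)
    ultimately show ?thesis by blast
  qed
qed

end
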